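(* For all integers $d\ge 2$ and $N\ge 1$, there exists a $(d,N,F)$ deterministic Port-Based State Preparation protocol with (worst-case) channel fidelity $$F_{\mathrm{wc}} = 1-\left(1-\frac{1}{d}\right)^N .$$
   Context: Deterministic Port-Based State Preparation (PBSP). Alice holds $N$ qudits $A=A_1\cdots A_N$ and Bob holds $N$ qudits $B=B_1\cdots B_N$ (each register is a copy of $\mathbb{C}^d$). They share a fixed resource state $\rho_{AB}$ (a density operator on $A\otimes B$, chosen by the protocol and independent of the input). The input is the complete (arbitrarily precise) classical description $\psi$ of a pure state $|\psi\rangle\in\mathbb{C}^d$, known to Alice only. Alice performs on $A$ an $N$-outcome POVM $\{M_x(\psi)\}_{x=1}^N$, which may depend on $\psi$, and sends the outcome $x\in\{1,\dots,N\}$ to Bob. Bob traces out all of his registers except $B_x$ (the "port"). The output of the protocol on input $\psi$ is the state on $\mathbb{C}^d$ $$\Phi(\psi) = \sum_{x=1}^N \mathrm{Tr}_{A B_{\bar x}}\big[(M_x(\psi)\otimes I_B)\rho_{AB}\big],$$ where $B_{\bar x}$ denotes all of Bob's registers other than $B_x$, and each remaining register $B_x$ is identified with $\mathbb{C}^d$. The worst-case fidelity of the protocol is $$F_{\mathrm{wc}} = F_{\mathrm{wc}}(\Phi) = \inf_{|\psi\rangle\in\mathbb{C}^d,\ \||\psi\rangle\|=1}\langle\psi|\Phi(\psi)|\psi\rangle ,$$ and a $(d,N,F)$ deterministic PBSP protocol is one with fidelity $F=F_{\mathrm{wc}}$. *)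

theory Defs
  imports "HOL-Analysis.Analysis" "HOL-Library.Nonpos_Ints"
begin

text \<open>
  A finite-dimensional Hilbert space is \<open>complex^'i\<close>, where the finite type \<open>'i\<close> labels the
  computational basis.  A qudit has basis \<open>'d\<close>, so \<open>d = CARD('d)\<close>; the ports are labelled by
  \<open>'n\<close>, so \<open>N = CARD('n)\<close>.  The \<open>N\<close>-fold tensor power of the qudit space has basis \<open>'n \<Rightarrow> 'd\<close>,
  the label \<open>b\<close> standing for the product vector whose factor in register \<open>x\<close> is basis vector
  \<open>b x\<close>.  The tensor product of two spaces has as basis the product of the two label types.
\<close>

type_synonym 'i operator = "complex^'i^'i"

definition braket :: "complex^'i::finite \<Rightarrow> complex^'i \<Rightarrow> complex"
  where "braket v w = (\<Sum>i\<in>UNIV. cnj (v $ i) * w $ i)"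

definition ketbra :: "complex^'i::finite \<Rightarrow> 'i operator"
  where "ketbra v = (\<chi> i j. v $ i * cnj (v $ j))"

text \<open>Over the complex numbers this condition already forces \<open>T\<close> to be Hermitian.\<close>

definition positive_semidefinite :: "('i::finite) operator \<Rightarrow> bool"
  where "positive_semidefinite T \<longleftrightarrow> (\<forall>v. braket v (T *v v) \<in> \<real>\<^sub>\<ge>\<^sub>0)"

definition density_operator :: "('i::finite) operator \<Rightarrow> bool"
  where "density_operator T \<longleftrightarrow> positive_semidefinite T \<and> trace T = 1"

definition povm :: "('x::finite \<Rightarrow> ('i::finite) operator) \<Rightarrow> bool"
  where "povm E \<longleftrightarrow> (\<forall>x. positive_semidefinite (E x)) \<and> (\<Sum>x\<in>UNIV. E x) = mat 1"

definition tensor_op :: "('i::finite) operator \<Rightarrow> ('j::finite) operator \<Rightarrow> ('i \<times> 'j) operator"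
  where "tensor_op S T = (\<chi> p q. S $ fst p $ fst q * T $ snd p $ snd q)"

text \<open>
  Partial trace over all of \<open>A\<close> and over every register of \<open>B\<close> except register \<open>x\<close>.  The labels
  \<open>b\<close> and \<open>b(x := j)\<close> agree on the registers that are traced out; register \<open>x\<close> carries the
  row index \<open>i\<close> in the first and the column index \<open>j\<close> in the second.
\<close>

definition trace_out_except ::
    "'n \<Rightarrow> ('a::finite \<times> ('n::finite \<Rightarrow> 'd::finite)) operator \<Rightarrow> 'd operator"
  where "trace_out_except x T =
    (\<chi> i j. \<Sum>a\<in>UNIV. \<Sum>b\<in>{b. b x = i}. T $ (a, b) $ (a, b(x := j)))"

text \<open>
  A protocol is a resource state \<open>\<rho>\<close> on \<open>A \<otimes> B\<close> and, for every pure state, a POVM on \<open>A\<close> with one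
  outcome per port.  The pure state is passed to \<open>M\<close> as the projector \<open>ketbra \<psi>\<close>, so the
  measurement cannot depend on the unphysical global phase of \<open>\<psi>\<close>.
\<close>

type_synonym ('n, 'd) resource = "(('n \<Rightarrow> 'd) \<times> ('n \<Rightarrow> 'd)) operator"
type_synonym ('n, 'd) measurement = "'d operator \<Rightarrow> 'n \<Rightarrow> ('n \<Rightarrow> 'd) operator"

definition pbsp_protocol ::
    "('n::finite, 'd::finite) resource \<Rightarrow> ('n, 'd) measurement \<Rightarrow> bool"
  where "pbsp_protocol \<rho> M \<longleftrightarrow>
    density_operator \<rho> \<and> (\<forall>\<psi>. norm \<psi> = 1 \<longrightarrow> povm (M (ketbra \<psi>)))"

definition pbsp_output ::
    "('n::finite, 'd::finite) resource \<Rightarrow> ('n, 'd) measurement \<Rightarrow> 'd operator \<Rightarrow> 'd operator"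
  where "pbsp_output \<rho> M \<sigma> =
    (\<Sum>x\<in>UNIV. trace_out_except x (tensor_op (M \<sigma> x) (mat 1) ** \<rho>))"

text \<open>For a protocol the overlap below is a real number in \<open>{0..1}\<close>; \<open>Re\<close> only changes its type.\<close>

definition worst_case_fidelity ::
    "('n::finite, 'd::finite) resource \<Rightarrow> ('n, 'd) measurement \<Rightarrow> real"
  where "worst_case_fidelity \<rho> M =
    (INF \<psi>\<in>{\<psi>. norm \<psi> = 1}. Re (braket \<psi> (pbsp_output \<rho> M (ketbra \<psi>) *v \<psi>)))"

end

theory Submission imports Defs begin

text \<open>
  Alice and Bob share \<open>N\<close> maximally entangled pairs.  Alice measures every register with the
  projectors \<open>P\<close> and \<open>1 - P\<close>, where \<open>P\<close> is the transpose (the complex conjugate) of the projector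
  onto \<open>\<psi>\<close>, and announces some register in which she found \<open>P\<close>, if there is one.  In that case the
  announced port holds exactly \<open>\<psi>\<close>; otherwise every port is orthogonal to \<open>\<psi>\<close>.  Hence the
  fidelity is, for every \<open>\<psi>\<close>, the probability that at least one of \<open>N\<close> independent
  measurements finds \<open>P\<close>, each of which does so with probability \<open>1/d\<close>.
\<close>

definition tensor_family :: "('n::finite \<Rightarrow> ('d::finite) operator) \<Rightarrow> ('n \<Rightarrow> 'd) operator"
  where "tensor_family F = (\<chi> a b. \<Prod>y\<in>UNIV. F y $ a y $ b y)"

definition max_entangled :: "complex^(('n::finite \<Rightarrow> 'd::finite) \<times> ('n \<Rightarrow> 'd))"
  where "max_entangled =
    (\<chi> p. if fst p = snd p then complex_of_real (1 / sqrt (real CARD('n \<Rightarrow> 'd))) else 0)"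

text \<open>The effect for finding \<open>P\<close> in exactly the registers of
  \<open>S\<close>.\<close>

definition found_in :: "('d::finite) operator \<Rightarrow> ('n::finite) set \<Rightarrow> ('n \<Rightarrow> 'd) operator"
  where "found_in P S = tensor_family (\<lambda>y. if y \<in> S then P else mat 1 - P)"

text \<open>If \<open>S\<close> is empty, the announced port is arbitrary.\<close>

definition announced :: "'n set \<Rightarrow> 'n"
  where "announced S = (SOME y. y \<in> S)"

text \<open>An operator on Alice's half of a maximally entangled state acts as its transpose on
  Bob's half, so measuring \<open>transpose \<sigma>\<close> prepares \<open>\<sigma>\<close> at the
  port.\<close>

definition announce_measurement :: "('n::finite, 'd::finite) measurement"
  where "announce_measurement \<sigma> x = (\<Sum>S\<in>{S. announced S = x}. found_in (transpose \<sigma>) S)"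

definition hermitian_projector :: "('i::finite) operator \<Rightarrow> bool"
  where "hermitian_projector T \<longleftrightarrow> (\<forall>i j. cnj (T $ i $ j) = T $ j $ i) \<and> T ** T = T"

section \<open>Expanding products of sums\<close>

lemma prod_sum_UNIV:
  fixes f :: "'n::finite \<Rightarrow> 'd::finite \<Rightarrow> 'c::comm_semiring_1"
  shows "(\<Prod>y\<in>UNIV. \<Sum>k\<in>UNIV. f y k) = (\<Sum>b\<in>UNIV. \<Prod>y\<in>UNIV. f y (b y))"
  using prod_sum_PiE[of "UNIV :: 'n set" "\<lambda>_. UNIV :: 'd set" f]
  by (simp add: PiE_UNIV_domain)

text \<open>Used twice: on matrix entries it gives completeness of the effects, on traces it gives
  the total weight of all outcomes.\<close>

lemma prod_add_subsets:
  fixes f g :: "'n::finite \<Rightarrow> 'c::comm_ring_1"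
  shows "(\<Sum>S\<in>UNIV. \<Prod>y\<in>UNIV. if y \<in> S then f y else g y) = (\<Prod>y\<in>UNIV. f y + g y)"
proof -
  have "(\<Prod>y\<in>UNIV. if y \<in> S then f y else g y) = prod f S * prod g (UNIV - S)" for S
    by (simp add: prod.If_cases Compl_eq_Diff_UNIV)
  then show ?thesis
    by (simp add: prod_add)
qed

section \<open>Inner products, projectors and the measurement\<close>

lemma braket_add_right: "braket v (w + w') = braket v w + braket v w'"
  by (simp add: braket_def algebra_simps sum.distrib)

lemma braket_zero_right: "braket v 0 = 0"
  by (simp add: braket_def)

lemma braket_self: "braket v v = complex_of_real ((norm v)\<^sup>2)"
  by (simp add: braket_def norm_vec_def L2_set_def sum_nonneg mult.commute
      flip: complex_norm_square)

lemma braket_matrix_vector: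
  "braket v (T *v w) = (\<Sum>i\<in>UNIV. \<Sum>j\<in>UNIV. cnj (v $ i) * T $ i $ j * w $ j)"
  by (simp add: braket_def matrix_vector_mult_def sum_distrib_left mult.assoc)

text \<open>Self-adjointness and idempotence turn \<open>braket v (T *v v)\<close> into the squared
  norm of \<open>T *v v\<close>.\<close>

lemma hermitian_projector_positive_semidefinite:
  assumes "hermitian_projector T"
  shows "positive_semidefinite T"
proof -
  have "braket v (T *v w) = braket (T *v v) w" for v w
  proof -
    have "braket (T *v v) w = (\<Sum>j\<in>UNIV. \<Sum>i\<in>UNIV. cnj (v $ i) * T $ i $ j * w $ j)"
      using assms
      by (simp add: braket_def matrix_vector_mult_def hermitian_projector_def sum_distrib_right
          sum_distrib_left mult_ac)
    then show ?thesis
      unfolding braket_matrix_vector by (subst sum.swap) simp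
  qed
  then have "braket v (T *v v) = braket (T *v v) (T *v v)" for v
    using assms by (metis hermitian_projector_def matrix_vector_mul_assoc)
  then show ?thesis
    by (simp add: positive_semidefinite_def braket_self)
qed

lemma positive_semidefinite_sum:
  assumes "\<And>i. i \<in> I \<Longrightarrow> positive_semidefinite (T i)"
  shows "positive_semidefinite (\<Sum>i\<in>I. T i)"
  using assms
  by (induction I rule: infinite_finite_induct)
    (auto simp: positive_semidefinite_def braket_zero_right braket_add_right
      matrix_vector_mult_add_rdistrib intro!: nonneg_Reals_add_I)

lemma ketbra_square:
  assumes "norm v = 1"
  shows "ketbra v ** ketbra v = ketbra v"
proof -
  have "(\<Sum>k\<in>UNIV. v $ i * cnj (v $ k) * (v $ k * cnj (v $ j))) = v $ i * cnj (v $ j)" for i j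
  proof -
    have "(\<Sum>k\<in>UNIV. v $ i * cnj (v $ k) * (v $ k * cnj (v $ j)))
        = v $ i * cnj (v $ j) * braket v v"
      by (simp add: braket_def sum_distrib_left mult_ac)
    with assms show ?thesis by (simp add: braket_self)
  qed
  then show ?thesis
    by (simp add: ketbra_def matrix_matrix_mult_def vec_eq_iff)
qed

lemma hermitian_projector_ketbra:
  "norm v = 1 \<Longrightarrow> hermitian_projector (ketbra v)"
  by (simp add: hermitian_projector_def ketbra_square) (simp add: ketbra_def)

lemma hermitian_projector_transpose:
  "hermitian_projector T \<Longrightarrow> hermitian_projector (transpose T)"
proof -
  assume T: "hermitian_projector T"
  have "transpose T ** transpose T = transpose (T ** T)"
    by (simp add: matrix_transpose_mul)
  with T show "hermitian_projector (transpose T)"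
    by (simp add: hermitian_projector_def) (simp add: transpose_def)
qed

lemma hermitian_projector_complement:
  assumes "hermitian_projector T"
  shows "hermitian_projector (mat 1 - T)"
proof -
  have "(mat 1 - T) ** (mat 1 - T) = mat 1 - T - (T - T ** T)"
    by (simp add: matrix_matrix_mult_def vec_eq_iff mat_def algebra_simps sum_subtractf sum.distrib
        if_distrib[of "\<lambda>z. z * _"] if_distrib[of "\<lambda>z. _ * z"] cong: if_cong)
  with assms show ?thesis
    by (simp add: hermitian_projector_def) (simp add: mat_def)
qed

text \<open>The sum over the middle label of a matrix product factors register by register, so
  idempotence is inherited from the factors.\<close>

lemma hermitian_projector_tensor_family:
  assumes "\<And>y. hermitian_projector (F y)"
  shows "hermitian_projector (tensor_family F)"
proof -
  have "(\<Sum>c\<in>UNIV. (\<Prod>y\<in>UNIV. F y $ a y $ c y) * (\<Prod>y\<in>UNIV. F y $ c y $ b y))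
      = (\<Prod>y\<in>UNIV. F y $ a y $ b y)" for a b
  proof -
    have "(\<Sum>c\<in>UNIV. (\<Prod>y\<in>UNIV. F y $ a y $ c y) * (\<Prod>y\<in>UNIV. F y $ c y $ b y))
        = (\<Prod>y\<in>UNIV. (F y ** F y) $ a y $ b y)"
      by (simp add: matrix_matrix_mult_def prod_sum_UNIV prod.distrib)
    with assms show ?thesis by (simp add: hermitian_projector_def)
  qed
  with assms show ?thesis
    by (simp add: hermitian_projector_def tensor_family_def matrix_matrix_mult_def vec_eq_iff)
qed

text \<open>Entrywise, the sum over subsets is the expansion of a product with factors
  \<open>P + (mat 1 - P)\<close>, that is, of Kronecker deltas.\<close>

lemma sum_found_in: "(\<Sum>S\<in>UNIV. found_in P S) = mat 1"
proof -
  have "(\<Sum>S\<in>UNIV. found_in P S) $ a $ b = mat 1 $ a $ b" for a b :: "'a \<Rightarrow> 'b"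
  proof -
    have "(\<Sum>S\<in>UNIV. found_in P S) $ a $ b
        = (\<Sum>S\<in>UNIV. \<Prod>y\<in>UNIV. if y \<in> S then P $ a y $ b y else (mat 1 - P) $ a y $ b y)"
      by (simp add: found_in_def tensor_family_def if_distrib[of "\<lambda>T. T $ _ $ _"] cong: if_cong)
    also have "\<dots> = (\<Prod>y\<in>UNIV. if a y = b y then 1 else 0)"
      unfolding prod_add_subsets by (simp add: mat_def)
    also have "\<dots> = (if a = b then 1 else 0)"
      by (auto simp: fun_eq_iff)
    finally show ?thesis by (simp add: mat_def)
  qed
  then show ?thesis by (simp add: vec_eq_iff)
qed

lemma povm_announce_measurement:
  fixes \<psi> :: "complex^'d::finite"
  assumes "norm \<psi> = 1"
  shows "povm ((announce_measurement :: ('n::finite, 'd) measurement) (ketbra \<psi>))"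
proof -
  have "positive_semidefinite (found_in (transpose (ketbra \<psi>)) S)" for S :: "'n set"
    unfolding found_in_def using assms
    by (intro hermitian_projector_positive_semidefinite hermitian_projector_tensor_family)
      (simp add: hermitian_projector_complement hermitian_projector_transpose
        hermitian_projector_ketbra)
  \<comment> \<open>Each \<open>S\<close> has exactly one announced port, so grouping by port only
    rearranges the sum over all subsets.\<close>
  moreover have "(\<Sum>x\<in>UNIV. (announce_measurement :: ('n, 'd) measurement) \<sigma> x) = mat 1" for \<sigma>
    using sum.group[of UNIV UNIV announced "found_in (transpose \<sigma>) :: 'n set \<Rightarrow> _"]
    by (simp add: announce_measurement_def sum_found_in)
  ultimately show ?thesis
    by (simp add: povm_def announce_measurement_def positive_semidefinite_sum)
qed

section \<open>The resource state and what it leaves at a port\<close>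

lemma ketbra_max_entangled:
  "ketbra (max_entangled :: complex^(('n::finite \<Rightarrow> 'd::finite) \<times> ('n \<Rightarrow> 'd))) $ p $ q =
    (if fst p = snd p \<and> fst q = snd q then 1 / of_nat CARD('d) ^ CARD('n) else 0)"
proof -
  have "complex_of_real (1 / sqrt (real CARD('n \<Rightarrow> 'd))) * complex_of_real (1 / sqrt (real CARD('n \<Rightarrow> 'd)))
      = 1 / of_nat CARD('d) ^ CARD('n)"
    by (simp add: card_fun flip: of_real_mult)
  then show ?thesis
    by (simp add: ketbra_def max_entangled_def)
qed

lemma norm_max_entangled:
  "norm (max_entangled :: complex^(('n::finite \<Rightarrow> 'd::finite) \<times> ('n \<Rightarrow> 'd))) = 1"
proof -
  have "(\<Sum>p\<in>UNIV. (norm ((max_entangled :: complex^(('n \<Rightarrow> 'd) \<times> ('n \<Rightarrow> 'd))) $ p))\<^sup>2)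
      = (\<Sum>a\<in>(UNIV :: ('n \<Rightarrow> 'd) set). \<Sum>b\<in>UNIV. if a = b then 1 / real CARD('n \<Rightarrow> 'd) else 0)"
    unfolding UNIV_Times_UNIV[symmetric] sum.cartesian_product
    by (intro sum.cong) (auto simp: max_entangled_def norm_divide power_divide)
  then show ?thesis
    by (simp add: norm_vec_def L2_set_def)
qed

lemma density_operator_ketbra:
  assumes "norm v = 1"
  shows "density_operator (ketbra v)"
proof -
  have "trace (ketbra v) = braket v v"
    by (simp add: trace_def ketbra_def braket_def mult.commute)
  with assms show ?thesis
    by (simp add: density_operator_def braket_self hermitian_projector_positive_semidefinite
        hermitian_projector_ketbra)
qed

text \<open>The resource forces Alice's and Bob's labels to agree. Hence the port holds, up to
  normalisation, the transpose of the partial trace of \<open>T\<close> over the other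
  registers.\<close>

lemma trace_out_except_max_entangled:
  fixes T :: "('n::finite \<Rightarrow> 'd::finite) operator"
  shows "trace_out_except x (tensor_op T (mat 1) ** ketbra max_entangled) $ i $ j =
    (\<Sum>b\<in>{b. b x = i}. T $ (b(x := j)) $ b) / of_nat CARD('d) ^ CARD('n)"
proof -
  have entry: "(tensor_op T (mat 1) ** ketbra max_entangled) $ (a, b) $ (a, b') =
      (if a = b' then T $ b' $ b / of_nat CARD('d) ^ CARD('n) else 0)" for a b b'
  proof -
    have "(tensor_op T (mat 1) ** ketbra max_entangled) $ (a, b) $ (a, b')
      = (\<Sum>c\<in>UNIV. \<Sum>e\<in>UNIV. if b = e then (if c = e \<and> a = b' then T $ a $ c / of_nat CARD('d) ^ CARD('n) else 0) else 0)"
      unfolding matrix_matrix_mult_def UNIV_Times_UNIV[symmetric] sum.cartesian_product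
      by (simp add: tensor_op_def ketbra_max_entangled mat_def)
         (intro sum.cong; auto)
    also have "\<dots> = (\<Sum>c\<in>UNIV. if c = b then (if a = b' then T $ a $ c / of_nat CARD('d) ^ CARD('n) else 0) else 0)"
      by (intro sum.cong) auto
    finally show ?thesis by simp
  qed
  show ?thesis
    unfolding trace_out_except_def
    by (simp add: entry) (subst sum.swap, simp add: sum_divide_distrib)
qed

lemma sum_tensor_family_port:
  "(\<Sum>b\<in>{b. b x = i}. tensor_family F $ (b(x := j)) $ b)
    = F x $ j $ i * (\<Prod>y\<in>UNIV - {x}. trace (F y))"
proof -
  \<comment> \<open>The constraint \<open>b x = i\<close> becomes an indicator inside the factor at
    \<open>x\<close>, so the sum runs over all labels and factors by
    \<open>prod_sum_UNIV\<close>.\<close>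
  define G where "G y k = (if y = x then if k = i then F x $ j $ i else 0 else F y $ k $ k)" for y k
  have "(\<Prod>y\<in>UNIV. G y (b y)) = (if b x = i then tensor_family F $ (b(x := j)) $ b else 0)" for b
  proof -
    have "(\<Prod>y\<in>UNIV - {x}. G y (b y)) = (\<Prod>y\<in>UNIV - {x}. F y $ (b(x := j)) y $ b y)"
      by (intro prod.cong) (auto simp: G_def)
    then show ?thesis
      by (simp add: tensor_family_def prod.remove[of UNIV x] G_def)
  qed
  then have "(\<Sum>b\<in>{b. b x = i}. tensor_family F $ (b(x := j)) $ b) = (\<Sum>b\<in>UNIV. \<Prod>y\<in>UNIV. G y (b y))"
    by (simp add: sum.If_cases)
  also have "\<dots> = (\<Prod>y\<in>UNIV. \<Sum>k\<in>UNIV. G y k)"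
    by (rule prod_sum_UNIV[symmetric])
  also have "\<dots> = (\<Sum>k\<in>UNIV. G x k) * (\<Prod>y\<in>UNIV - {x}. \<Sum>k\<in>UNIV. G y k)"
    by (simp add: prod.remove[of UNIV x])
  also have "(\<Prod>y\<in>UNIV - {x}. \<Sum>k\<in>UNIV. G y k) = (\<Prod>y\<in>UNIV - {x}. trace (F y))"
    by (intro prod.cong) (auto simp: G_def trace_def)
  also have "(\<Sum>k\<in>UNIV. G x k) = F x $ j $ i"
    by (simp add: G_def)
  finally show ?thesis .
qed

section \<open>Overlap of the output with the input\<close>

lemma overlap_ketbra: "braket \<psi> (ketbra \<psi> *v \<psi>) = (braket \<psi> \<psi>)\<^sup>2"
  by (simp add: braket_matrix_vector) (simp add: ketbra_def braket_def power2_eq_square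
      sum_product mult_ac)

lemma trace_transpose_ketbra: "trace (transpose (ketbra \<psi>)) = braket \<psi> \<psi>"
  by (simp add: trace_def transpose_def ketbra_def braket_def mult.commute)

text \<open>The two transposes cancel: port \<open>x\<close> carries \<open>ketbra \<psi>\<close> if
  \<open>x \<in> S\<close> and its complement otherwise, with overlap 1 or 0. The remaining
  registers contribute their traces, 1 or \<open>d - 1\<close>.\<close>

lemma overlap_found_in:
  fixes \<psi> :: "complex^'d::finite" and S :: "'n::finite set"
  assumes "norm \<psi> = 1"
  shows "(\<Sum>i\<in>UNIV. \<Sum>j\<in>UNIV. cnj (\<psi> $ i) *
      (\<Sum>b\<in>{b. b x = i}. found_in (transpose (ketbra \<psi>)) S $ (b(x := j)) $ b) * \<psi> $ j)
    = (if x \<in> S then \<Prod>y\<in>UNIV. if y \<in> S then 1 else of_nat CARD('d) - 1 else 0)"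
proof -
  define F where "F y = (if y \<in> S then transpose (ketbra \<psi>) else mat 1 - transpose (ketbra \<psi>))" for y
  have tr: "trace (F y) = (if y \<in> S then 1 else of_nat CARD('d) - 1)" for y
    using assms by (simp add: F_def trace_sub trace_I trace_transpose_ketbra braket_self)
  have "(\<Sum>i\<in>UNIV. \<Sum>j\<in>UNIV. cnj (\<psi> $ i) *
      (\<Sum>b\<in>{b. b x = i}. found_in (transpose (ketbra \<psi>)) S $ (b(x := j)) $ b) * \<psi> $ j)
    = braket \<psi> (transpose (F x) *v \<psi>) * (\<Prod>y\<in>UNIV - {x}. trace (F y))"
    unfolding found_in_def F_def[symmetric] sum_tensor_family_port braket_matrix_vector
    by (simp add: sum_distrib_left sum_distrib_right mult_ac transpose_def)
  also have "braket \<psi> (transpose (F x) *v \<psi>) = (if x \<in> S then 1 else 0)"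
  proof (cases "x \<in> S")
    case True
    with assms show ?thesis by (simp add: F_def overlap_ketbra braket_self)
  next
    case False
    have "transpose (F x) = mat 1 - ketbra \<psi>"
      using False by (simp add: F_def transpose_def mat_def vec_eq_iff)
    moreover have "braket \<psi> ((mat 1 - ketbra \<psi>) *v \<psi>) = braket \<psi> \<psi> - braket \<psi> (ketbra \<psi> *v \<psi>)"
      by (simp add: matrix_vector_mult_diff_rdistrib braket_def sum_subtractf algebra_simps)
    ultimately show ?thesis using False assms by (simp add: overlap_ketbra braket_self)
  qed
  \<comment> \<open>When \<open>x \<in> S\<close> the missing factor at \<open>x\<close> is 1, so
    the product extends to all registers and no longer depends on \<open>x\<close>.\<close>
  also have "(if x \<in> S then 1 else 0) * (\<Prod>y\<in>UNIV - {x}. trace (F y))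
    = (if x \<in> S then \<Prod>y\<in>UNIV. if y \<in> S then 1 else of_nat CARD('d) - 1 else 0)"
    by (simp add: tr prod.remove[of UNIV x])
  finally show ?thesis .
qed

lemma overlap_pbsp_output:
  fixes \<psi> :: "complex^'d::finite"
  assumes "norm \<psi> = 1"
  shows "braket \<psi> (pbsp_output (ketbra max_entangled) (announce_measurement :: ('n::finite, 'd) measurement)
      (ketbra \<psi>) *v \<psi>) = 1 - (1 - 1 / of_nat CARD('d)) ^ CARD('n)"
proof -
  let ?d = "of_nat CARD('d) :: complex"
  let ?R = "found_in (transpose (ketbra \<psi>)) :: 'n set \<Rightarrow> _"
  define V where "V x S = (\<Sum>i\<in>UNIV. \<Sum>j\<in>UNIV. cnj (\<psi> $ i) *
      (\<Sum>b\<in>{b. b x = i}. ?R S $ (b(x := j)) $ b) * \<psi> $ j)" for x S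
  \<comment> \<open>Divided by \<open>?d ^ CARD('n)\<close>, this is the probability that
    \<open>P\<close> is found exactly on \<open>S\<close>.\<close>
  define W where "W S = (\<Prod>y\<in>(UNIV :: 'n set). if y \<in> S then 1 else ?d - 1)" for S
  \<comment> \<open>A nonempty \<open>S\<close> contains its announced port and counts fully. The
    empty set contributes 0 whatever port is announced, so its weight \<open>W {}\<close> is
    subtracted.\<close>
  have V: "V (announced S) S = W S - (if S = {} then (?d - 1) ^ CARD('n) else 0)" for S
    using some_in_eq[of S] by (simp add: V_def W_def overlap_found_in[OF assms] announced_def)
  \<comment> \<open>Each register contributes the factor \<open>1 + (?d - 1)\<close>.\<close>
  have sumW: "(\<Sum>S\<in>UNIV. W S) = ?d ^ CARD('n)"
    unfolding W_def by (subst prod_add_subsets) simp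
  have out: "pbsp_output (ketbra max_entangled) (announce_measurement :: ('n, 'd) measurement)
      (ketbra \<psi>) $ i $ j
      = (\<Sum>x\<in>UNIV. \<Sum>S\<in>{S. announced S = x}. \<Sum>b\<in>{b. b x = i}. ?R S $ (b(x := j)) $ b) / ?d ^ CARD('n)"
    for i j
    unfolding pbsp_output_def
    by (simp add: trace_out_except_max_entangled announce_measurement_def sum_divide_distrib)
       (intro sum.cong refl, subst sum.swap, simp)
  have "braket \<psi> (pbsp_output (ketbra max_entangled) (announce_measurement :: ('n, 'd) measurement)
      (ketbra \<psi>) *v \<psi>) = (\<Sum>x\<in>UNIV. \<Sum>S\<in>{S. announced S = x}. V x S) / ?d ^ CARD('n)"
  proof -
    have "(\<Sum>x\<in>UNIV. \<Sum>S\<in>{S. announced S = x}. V x S) =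
      (\<Sum>i\<in>UNIV. \<Sum>j\<in>UNIV. \<Sum>x\<in>UNIV. \<Sum>S\<in>{S. announced S = x}. cnj (\<psi> $ i) *
      (\<Sum>b\<in>{b. b x = i}. ?R S $ (b(x := j)) $ b) * \<psi> $ j)"
      unfolding V_def
      by (simp add: sum.swap[of _ "UNIV :: 'd set" "{S. announced S = _}"]
                    sum.swap[of _ "UNIV :: 'd set" "UNIV :: 'n set"])
    then show ?thesis
      unfolding braket_matrix_vector out
      by (simp add: sum_distrib_left sum_distrib_right sum_divide_distrib)
  qed
  also have "(\<Sum>x\<in>UNIV. \<Sum>S\<in>{S. announced S = x}. V x S) = (\<Sum>S\<in>UNIV. V (announced S) S)"
    by (subst sum.group[of UNIV UNIV announced "\<lambda>S. V (announced S) S", symmetric]) simp_all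
  also have "\<dots> = ?d ^ CARD('n) - (?d - 1) ^ CARD('n)"
    by (simp add: V sum_subtractf sumW)
  also have "\<dots> / ?d ^ CARD('n) = 1 - (1 - 1 / ?d) ^ CARD('n)"
  proof -
    have "1 - 1 / ?d = (?d - 1) / ?d"
      by (simp add: divide_simps)
    then show ?thesis
      by (simp only: power_divide) (simp add: diff_divide_distrib)
  qed
  finally show ?thesis .
qed

theorem theorem3p2:
  assumes "CARD('d::finite) \<ge> 2"
  shows "\<exists>(\<rho> :: ('n::finite, 'd) resource) (M :: ('n, 'd) measurement).
    pbsp_protocol \<rho> M \<and>
    worst_case_fidelity \<rho> M = 1 - (1 - 1 / real CARD('d)) ^ CARD('n)"
proof (intro exI conjI)
  let ?\<rho> = "ketbra max_entangled :: ('n, 'd) resource"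
  let ?M = "announce_measurement :: ('n, 'd) measurement"
  let ?F = "1 - (1 - 1 / real CARD('d)) ^ CARD('n)"
  show "pbsp_protocol ?\<rho> ?M"
    by (simp add: pbsp_protocol_def density_operator_ketbra norm_max_entangled
        povm_announce_measurement)
  have "1 - (1 - 1 / of_nat CARD('d)) ^ CARD('n) = complex_of_real ?F"
    by simp
  then have "Re (braket \<psi> (pbsp_output ?\<rho> ?M (ketbra \<psi>) *v \<psi>)) = ?F" if "norm \<psi> = 1" for \<psi>
    by (simp only: overlap_pbsp_output[OF that] Re_complex_of_real)
  \<comment> \<open>The overlap is constant in \<psi>, but its infimum equals that constant only
    over a nonempty set; any basis vector serves as the witness.\<close>
  moreover have "norm (axis undefined 1 :: complex^'d) = 1"
    by (simp add: norm_axis_1)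
  then have "{\<psi> :: complex^'d. norm \<psi> = 1} \<noteq> {}"
    by blast
  ultimately show "worst_case_fidelity ?\<rho> ?M = ?F"
    by (simp add: worst_case_fidelity_def)
qed

end
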